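(* Let $k\ge 1$ be an integer and let $\mathcal{F}$ be a sunflower-free $k$-uniform set system (a family of $k$-element subsets of a finite set $\{1,\dots,n\}$). Let $M:=\left|\bigcup_{F\in\mathcal{F}}F\right|$. Then $$ |\mathcal{F}|\le 3\left(\left\lceil\frac{2k}{3}\right\rceil+1\right)\left(2^{1/3}\cdot 3e\right)^k\left(\left\lceil\frac Mk\right\rceil-1\right)^{\left\lceil\frac{2k}{3}\right\rceil}. $$
   Context: A family of sets is $k$-uniform if each of its members has exactly $k$ elements. Three distinct sets $F_1,F_2,F_3$ form a sunflower (with 3 petals) if $F_i\cap F_j=F_1\cap F_2\cap F_3$ for all $1\le i<j\le 3$ (pairwise disjoint sets form a sunflower with empty kernel). A family is sunflower-free if no three distinct members of it form a sunflower. $e$ is the base of the natural logarithm.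
   Formalization: The formal theorem also assumes M > k, i.e. that the family has at least two members; for a one-member family M = k and the right side is 0 while |F| = 1, and for the empty family the right side is negative when ⌈2k/3⌉ is odd. *)

theory Defs
  imports Complex_Main
begin

definition uniform_family :: "nat \<Rightarrow> 'a set set \<Rightarrow> bool" where
  "uniform_family k \<F> \<longleftrightarrow> (\<forall>F\<in>\<F>. finite F \<and> card F = k)"

definition sunflower3 :: "'a set \<Rightarrow> 'a set \<Rightarrow> 'a set \<Rightarrow> bool" where
  "sunflower3 F1 F2 F3 \<longleftrightarrow>
     F1 \<noteq> F2 \<and> F1 \<noteq> F3 \<and> F2 \<noteq> F3 \<and>
     F1 \<inter> F2 = F1 \<inter> F2 \<inter> F3 \<and>
     F1 \<inter> F3 = F1 \<inter> F2 \<inter> F3 \<and>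
     F2 \<inter> F3 = F1 \<inter> F2 \<inter> F3"

definition sunflower_free :: "'a set set \<Rightarrow> bool" where
  "sunflower_free \<F> \<longleftrightarrow> \<not> (\<exists>F1\<in>\<F>. \<exists>F2\<in>\<F>. \<exists>F3\<in>\<F>. sunflower3 F1 F2 F3)"

end

theory Submission
  imports Defs "HOL-Library.FuncSet"
begin

text \<open>
  Put $D = \lceil M/k \rceil$ and add dummy points so that the ground set has exactly $kD$ elements.
  Averaging over all colourings of it with $k$ classes of size $D$, some colouring makes at least a
  fraction $D^k / {kD \choose k} \ge k!/k^k \ge e^{-k}$ of the family transversal, that is, with one
  element in every colour class.

  A transversal sunflower-free family is bounded by the slice rank method of Naslund and Sawin, with
  the tensor
  $T(F_1,F_2,F_3) = \prod_i (|F_1 \cap F_2 \cap V_i| + |F_2 \cap F_3 \cap V_i| + |F_1 \cap F_3 \cap V_i| - 1)$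
  over the colour classes $V_i$. A factor vanishes iff exactly two of the three points of the $F_j$ in
  $V_i$ coincide, so $T$ is diagonal with nonzero diagonal. Expanding the product gives monomials
  $[A \subseteq F_1][B \subseteq F_2][C \subseteq F_3]$ with partial transversals $A,B,C$ and
  $|A|+|B|+|C| \le 2k$, so one of the three has at most $2k/3$ elements, and there are at most
  $2^k D^{\lfloor 2k/3 \rfloor}$ of these. Finally $D \le 2(D-1)$ and $2 \cdot 2^{2/3} \le 3 \cdot 2^{1/3}$.
\<close>

subsection \<open>Slice rank\<close>

text \<open>Gaussian elimination, one equation per induction step: a pivot \<open>p\<close> is
  removed together with an equation \<open>c\<close>, so the surplus of unknowns persists. Vanishing
  off \<open>S\<close> makes it possible to add \<open>h\<close> to a solution on a larger
  set.\<close>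

lemma homogeneous_system_solution:
  fixes f :: "'c \<Rightarrow> 's \<Rightarrow> 'k::field"
  assumes "finite C" "finite S" "card C < card S"
  shows "\<exists>h. (\<exists>s\<in>S. h s \<noteq> 0) \<and> (\<forall>s. s \<notin> S \<longrightarrow> h s = 0) \<and>
           (\<forall>c\<in>C. (\<Sum>s\<in>S. h s * f c s) = 0)"
  using assms
proof (induction C arbitrary: S f rule: finite_induct)
  case empty
  then obtain s where "s \<in> S" by (metis card.empty equals0I less_irrefl)
  then show ?case by (intro exI[of _ "\<lambda>t. of_bool (t \<in> S)"]) auto
next
  case (insert c C)
  show ?case
  proof (cases "\<forall>s\<in>S. f c s = 0")
    case True
    have "card C < card S" using insert.hyps insert.prems by simp
    from insert.IH[OF \<open>finite S\<close> this, of f]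
    obtain h where "\<exists>s\<in>S. h s \<noteq> 0" "\<forall>s. s \<notin> S \<longrightarrow> h s = 0"
        "\<forall>d\<in>C. (\<Sum>s\<in>S. h s * f d s) = 0"
      by (elim exE conjE)
    with True show ?thesis by (intro exI[of _ h]) simp
  next
    case False
    then obtain p where p: "p \<in> S" "f c p \<noteq> 0" by blast
    define S' where "S' = S - {p}"
    have S': "finite S'" "card C < card S'" "S = insert p S'" "p \<notin> S'"
      using insert.hyps insert.prems p by (auto simp: S'_def)
    \<comment> \<open>Row \<open>d\<close> minus the multiple of row \<open>c\<close> that clears
      its entry at \<open>p\<close>.\<close>
    define f' where "f' d s = f d s - f d p * f c s / f c p" for d s
    from insert.IH[OF S'(1,2), of f']
    obtain h where h: "\<exists>s\<in>S'. h s \<noteq> 0" "\<forall>s. s \<notin> S' \<longrightarrow> h s = 0"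
        "\<forall>d\<in>C. (\<Sum>s\<in>S'. h s * f' d s) = 0"
      by (elim exE conjE)
    \<comment> \<open>The value at \<open>p\<close> is the one forced by equation
      \<open>c\<close>.\<close>
    define h' where "h' = h(p := - (\<Sum>s\<in>S'. h s * f c s) / f c p)"
    have split: "(\<Sum>s\<in>S. h' s * f d s) =
        (\<Sum>s\<in>S'. h s * f d s) - (\<Sum>s\<in>S'. h s * f c s) / f c p * f d p" for d
    proof -
      have "(\<Sum>s\<in>S'. h' s * f d s) = (\<Sum>s\<in>S'. h s * f d s)"
        using S'(4) by (intro sum.cong) (auto simp: h'_def)
      then show ?thesis using S' by (simp add: h'_def)
    qed
    have "(\<Sum>s\<in>S. h' s * f d s) = 0" if "d \<in> C" for d
    proof -
      have "(\<Sum>s\<in>S'. h s * f' d s) =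
          (\<Sum>s\<in>S'. h s * f d s) - (\<Sum>s\<in>S'. h s * f c s) / f c p * f d p"
        by (simp add: f'_def algebra_simps sum_subtractf sum_distrib_left sum_divide_distrib)
      then show ?thesis using h(3) that split by simp
    qed
    moreover have "(\<Sum>s\<in>S. h' s * f c s) = 0" using p by (simp add: split)
    moreover have "\<exists>s\<in>S. h' s \<noteq> 0"
      using h(1) S'(3,4) by (auto simp: h'_def)
    moreover have "\<forall>s. s \<notin> S \<longrightarrow> h' s = 0"
      using h(2) S'(3) by (auto simp: h'_def)
    ultimately show ?thesis by blast
  qed
qed

text \<open>A solution of maximal support works: if it had more than \<open>card C\<close> zeros, a
  nonzero solution supported on those zeros could be added without cancellation, enlarging the
  support.\<close>

lemma homogeneous_system_large_support:
  fixes f :: "'c \<Rightarrow> 's \<Rightarrow> 'k::field"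
  assumes "finite C" "finite G"
  shows "\<exists>h. (\<forall>c\<in>C. (\<Sum>s\<in>G. h s * f c s) = 0) \<and>
           card G \<le> card {s \<in> G. h s \<noteq> 0} + card C"
proof -
  define P where "P h \<longleftrightarrow> (\<forall>c\<in>C. (\<Sum>s\<in>G. h s * f c s) = 0)" for h
  have "P (\<lambda>_. 0)" by (simp add: P_def)
  moreover have "\<forall>h. P h \<longrightarrow> card {s \<in> G. h s \<noteq> 0} < Suc (card G)"
    using assms by (auto simp: less_Suc_eq_le intro: card_mono)
  ultimately have "\<exists>h. P h \<and>
      (\<forall>h'. P h' \<longrightarrow> card {s \<in> G. h' s \<noteq> 0} \<le> card {s \<in> G. h s \<noteq> 0})"
    by (rule ex_has_greatest_nat)
  then obtain h where h: "P h"
      and max: "\<forall>h'. P h' \<longrightarrow> card {s \<in> G. h' s \<noteq> 0} \<le> card {s \<in> G. h s \<noteq> 0}"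
    by (elim exE conjE)
  define Z where "Z = {s \<in> G. h s = 0}"
  have Z: "Z \<subseteq> G" "finite Z" using assms by (auto simp: Z_def)
  have "card Z \<le> card C"
  proof (rule ccontr)
    assume "\<not> card Z \<le> card C"
    then obtain u where u: "\<exists>s\<in>Z. u s \<noteq> 0" "\<forall>s. s \<notin> Z \<longrightarrow> u s = 0"
        "\<forall>c\<in>C. (\<Sum>s\<in>Z. u s * f c s) = 0"
      using homogeneous_system_solution[of C Z f] assms Z by auto
    have "(\<Sum>s\<in>G. u s * f c s) = (\<Sum>s\<in>Z. u s * f c s)" for c
      using u(2) assms Z by (intro sum.mono_neutral_right) auto
    then have "P (\<lambda>s. h s + u s)"
      using h u(3) by (simp add: P_def algebra_simps sum.distrib)
    moreover have "{s \<in> G. h s \<noteq> 0} \<subset> {s \<in> G. h s + u s \<noteq> 0}"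
      using u(1,2) by (auto simp: Z_def)
    then have "card {s \<in> G. h s \<noteq> 0} < card {s \<in> G. h s + u s \<noteq> 0}"
      using assms by (intro psubset_card_mono) auto
    ultimately show False using max by fastforce
  qed
  moreover have "card G = card {s \<in> G. h s \<noteq> 0} + card Z"
    unfolding Z_def using assms
    by (subst card_Un_disjoint[symmetric]) (auto intro: arg_cong[of _ _ card])
  ultimately show ?thesis using h unfolding P_def by auto
qed

text \<open>
  Tao's argument: contracting the third variable with a vector orthogonal to all \<open>r c\<close> leaves a
  diagonal matrix of rank at least \<open>card G - card C\<close>, written as a sum of \<open>card A + card B\<close>
  matrices of rank one.
\<close>
lemma slice_rank_diagonal:
  fixes T :: "'x \<Rightarrow> 'x \<Rightarrow> 'x \<Rightarrow> 'k::field"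
  assumes fin: "finite G" "finite A" "finite B" "finite C"
    and diag: "\<And>x. x \<in> G \<Longrightarrow> T x x x \<noteq> 0"
    and off: "\<And>x y z. x \<in> G \<Longrightarrow> y \<in> G \<Longrightarrow> z \<in> G \<Longrightarrow> T x y z \<noteq> 0 \<Longrightarrow> x = y \<and> y = z"
    and slices: "\<And>x y z. x \<in> G \<Longrightarrow> y \<in> G \<Longrightarrow> z \<in> G \<Longrightarrow> T x y z =
      (\<Sum>a\<in>A. p a x * p' a y z) + (\<Sum>b\<in>B. q b y * q' b x z) + (\<Sum>c\<in>C. r c z * r' c x y)"
  shows "card G \<le> card A + card B + card C"
proof -
  obtain h where h: "\<forall>c\<in>C. (\<Sum>z\<in>G. h z * r c z) = 0"
      and big: "card G \<le> card {z \<in> G. h z \<noteq> 0} + card C"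
    using homogeneous_system_large_support[of C G r] fin by blast
  define S where "S = {z \<in> G. h z \<noteq> 0}"
  have S: "S \<subseteq> G" "finite S" using fin by (auto simp: S_def)
  \<comment> \<open>These are the functions of \<open>x\<close> in the rank-one terms left after
    contraction with \<open>h\<close>. A vector \<open>u\<close> orthogonal to all of them
    annihilates the contracted matrix.\<close>
  define f where "f = case_sum p (\<lambda>b x. \<Sum>z\<in>G. h z * q' b x z)"
  have "card S \<le> card (A <+> B)"
  proof (rule ccontr)
    assume "\<not> card S \<le> card (A <+> B)"
    then obtain u where u: "\<exists>s\<in>S. u s \<noteq> 0" "\<forall>c\<in>A <+> B. (\<Sum>s\<in>S. u s * f c s) = 0"
      using homogeneous_system_solution[of "A <+> B" S f] fin S by auto
    have uA: "(\<Sum>x\<in>S. u x * p a x) = 0" if "a \<in> A" for a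
      using u(2) that by (force simp: f_def)
    have uB: "(\<Sum>x\<in>S. u x * (\<Sum>z\<in>G. h z * q' b x z)) = 0" if "b \<in> B" for b
      using u(2) that by (force simp: f_def)
    obtain y where y: "y \<in> S" "u y \<noteq> 0" using u(1) by blast
    \<comment> \<open>The slices in the third variable disappear because \<open>h\<close> is
      orthogonal to every \<open>r c\<close>.\<close>
    have contract: "(\<Sum>z\<in>G. h z * T x y z) =
        (\<Sum>a\<in>A. p a x * (\<Sum>z\<in>G. h z * p' a y z)) +
        (\<Sum>b\<in>B. q b y * (\<Sum>z\<in>G. h z * q' b x z))" if "x \<in> S" for x
    proof -
      have "(\<Sum>z\<in>G. h z * T x y z) =
          (\<Sum>z\<in>G. \<Sum>a\<in>A. p a x * (h z * p' a y z)) +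
          (\<Sum>z\<in>G. \<Sum>b\<in>B. q b y * (h z * q' b x z)) +
          (\<Sum>z\<in>G. \<Sum>c\<in>C. r' c x y * (h z * r c z))"
        unfolding sum.distrib[symmetric]
      proof (intro sum.cong refl)
        fix z assume "z \<in> G"
        then show "h z * T x y z = (\<Sum>a\<in>A. p a x * (h z * p' a y z)) +
          (\<Sum>b\<in>B. q b y * (h z * q' b x z)) + (\<Sum>c\<in>C. r' c x y * (h z * r c z))"
          using slices[of x y z] S that y
          by (simp add: subset_iff distrib_left sum_distrib_left mult_ac)
      qed
      also have "(\<Sum>z\<in>G. \<Sum>c\<in>C. r' c x y * (h z * r c z)) = 0"
        by (subst sum.swap) (simp add: sum_distrib_left[symmetric] h)
      also have "(\<Sum>z\<in>G. \<Sum>a\<in>A. p a x * (h z * p' a y z)) =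
          (\<Sum>a\<in>A. p a x * (\<Sum>z\<in>G. h z * p' a y z))"
        by (subst sum.swap) (simp add: sum_distrib_left)
      also have "(\<Sum>z\<in>G. \<Sum>b\<in>B. q b y * (h z * q' b x z)) =
          (\<Sum>b\<in>B. q b y * (\<Sum>z\<in>G. h z * q' b x z))"
        by (subst sum.swap) (simp add: sum_distrib_left)
      finally show ?thesis by simp
    qed
    have "(\<Sum>x\<in>S. u x * (\<Sum>z\<in>G. h z * T x y z)) =
        (\<Sum>x\<in>S. \<Sum>a\<in>A. (\<Sum>z\<in>G. h z * p' a y z) * (u x * p a x)) +
        (\<Sum>x\<in>S. \<Sum>b\<in>B. q b y * (u x * (\<Sum>z\<in>G. h z * q' b x z)))"
      unfolding sum.distrib[symmetric]
      by (intro sum.cong refl) (simp add: contract distrib_left sum_distrib_left mult_ac)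
    also have "(\<Sum>x\<in>S. \<Sum>a\<in>A. (\<Sum>z\<in>G. h z * p' a y z) * (u x * p a x)) = 0"
      by (subst sum.swap) (simp add: sum_distrib_left[symmetric] uA)
    also have "(\<Sum>x\<in>S. \<Sum>b\<in>B. q b y * (u x * (\<Sum>z\<in>G. h z * q' b x z))) = 0"
      by (subst sum.swap) (simp add: sum_distrib_left[symmetric] uB)
    finally have zero: "(\<Sum>x\<in>S. u x * (\<Sum>z\<in>G. h z * T x y z)) = 0" by simp
    \<comment> \<open>On \<open>S\<close>, column \<open>y\<close> of the contracted matrix has the
      single entry \<open>h y * T y y y\<close>, which is nonzero because
      \<open>y \<in> S\<close>.\<close>
    have "(\<Sum>z\<in>G. h z * T x y z) = (if x = y then h y * T y y y else 0)" if "x \<in> S" for x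
    proof -
      have "(\<Sum>z\<in>G. h z * T x y z) = (\<Sum>z\<in>G. if z = y then h y * T x y y else 0)"
        using off S that y by (intro sum.cong refl) (metis mult_zero_right subsetD)
      also have "\<dots> = h y * T x y y" using fin y S by (auto simp: sum.delta)
      also have "\<dots> = (if x = y then h y * T y y y else 0)"
        using off S that y by (metis mult_zero_right subsetD)
      finally show ?thesis .
    qed
    then have "(\<Sum>x\<in>S. u x * (\<Sum>z\<in>G. h z * T x y z)) =
        (\<Sum>x\<in>S. if x = y then u y * (h y * T y y y) else 0)"
      by (intro sum.cong refl) auto
    also have "\<dots> = u y * (h y * T y y y)" using S y by simp
    finally show False using zero y diag by (auto simp: S_def)
  qed
  then show ?thesis using big fin by (simp add: S_def card_Plus)
qed

text \<open>Each monomial is charged to the first variable whose index lies in \<open>\<A>\<close>.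
  Monomials charged to the same variable with the same index merge into one slice, so each variable
  needs at most \<open>card \<A>\<close> slices.\<close>

lemma slice_rank_monomials:
  fixes T :: "'x \<Rightarrow> 'x \<Rightarrow> 'x \<Rightarrow> 'k::field"
  assumes fin: "finite G" "finite \<Gamma>" "finite \<A>"
    and diag: "\<And>x. x \<in> G \<Longrightarrow> T x x x \<noteq> 0"
    and off: "\<And>x y z. x \<in> G \<Longrightarrow> y \<in> G \<Longrightarrow> z \<in> G \<Longrightarrow> T x y z \<noteq> 0 \<Longrightarrow> x = y \<and> y = z"
    and expand: "\<And>x y z. x \<in> G \<Longrightarrow> y \<in> G \<Longrightarrow> z \<in> G \<Longrightarrow>
      T x y z = (\<Sum>g\<in>\<Gamma>. w g * \<phi> (a g) x * \<phi> (b g) y * \<phi> (d g) z)"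
    and small: "\<And>g. g \<in> \<Gamma> \<Longrightarrow> a g \<in> \<A> \<or> b g \<in> \<A> \<or> d g \<in> \<A>"
  shows "card G \<le> 3 * card \<A>"
proof -
  define \<Gamma>1 where "\<Gamma>1 = {g \<in> \<Gamma>. a g \<in> \<A>}"
  define \<Gamma>2 where "\<Gamma>2 = {g \<in> \<Gamma> - \<Gamma>1. b g \<in> \<A>}"
  define \<Gamma>3 where "\<Gamma>3 = \<Gamma> - \<Gamma>1 - \<Gamma>2"
  have fin': "finite \<Gamma>1" "finite \<Gamma>2" "finite \<Gamma>3"
    using fin by (auto simp: \<Gamma>1_def \<Gamma>2_def \<Gamma>3_def)
  have group: "(\<Sum>g\<in>\<Delta>. \<phi> (e g) x * v g) = (\<Sum>A\<in>\<A>. \<phi> A x * (\<Sum>g\<in>{g \<in> \<Delta>. e g = A}. v g))"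
    if "finite \<Delta>" "e ` \<Delta> \<subseteq> \<A>" for \<Delta> e x and v :: "_ \<Rightarrow> 'k"
  proof -
    have "(\<Sum>g\<in>\<Delta>. \<phi> (e g) x * v g) = (\<Sum>A\<in>\<A>. \<Sum>g\<in>{g \<in> \<Delta>. e g = A}. \<phi> (e g) x * v g)"
      by (rule sum.group[symmetric]) (use that fin in auto)
    then show ?thesis by (simp add: sum_distrib_left)
  qed
  have "card G \<le> card \<A> + card \<A> + card \<A>"
  proof (rule slice_rank_diagonal[OF fin(1) fin(3) fin(3) fin(3) diag off])
    fix x y z assume xyz: "x \<in> G" "y \<in> G" "z \<in> G"
    let ?t = "\<lambda>g. w g * \<phi> (a g) x * \<phi> (b g) y * \<phi> (d g) z"
    have "\<Gamma> = (\<Gamma>1 \<union> \<Gamma>2) \<union> \<Gamma>3" "\<Gamma>1 \<inter> \<Gamma>2 = {}" "(\<Gamma>1 \<union> \<Gamma>2) \<inter> \<Gamma>3 = {}"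
      by (auto simp: \<Gamma>1_def \<Gamma>2_def \<Gamma>3_def)
    then have "T x y z = sum ?t \<Gamma>1 + sum ?t \<Gamma>2 + sum ?t \<Gamma>3"
      using fin' by (simp add: expand[OF xyz] sum.union_disjoint)
    also have "sum ?t \<Gamma>1 = (\<Sum>g\<in>\<Gamma>1. \<phi> (a g) x * (w g * \<phi> (b g) y * \<phi> (d g) z))"
      by (simp add: mult_ac)
    also have "\<dots> = (\<Sum>A\<in>\<A>. \<phi> A x *
        (\<Sum>g\<in>{g \<in> \<Gamma>1. a g = A}. w g * \<phi> (b g) y * \<phi> (d g) z))"
      by (rule group) (use fin' in \<open>auto simp: \<Gamma>1_def\<close>)
    also have "sum ?t \<Gamma>2 = (\<Sum>g\<in>\<Gamma>2. \<phi> (b g) y * (w g * \<phi> (a g) x * \<phi> (d g) z))"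
      by (simp add: mult_ac)
    also have "\<dots> = (\<Sum>A\<in>\<A>. \<phi> A y *
        (\<Sum>g\<in>{g \<in> \<Gamma>2. b g = A}. w g * \<phi> (a g) x * \<phi> (d g) z))"
      by (rule group) (use fin' in \<open>auto simp: \<Gamma>2_def\<close>)
    also have "sum ?t \<Gamma>3 = (\<Sum>g\<in>\<Gamma>3. \<phi> (d g) z * (w g * \<phi> (a g) x * \<phi> (b g) y))"
      by (simp add: mult_ac)
    also have "\<dots> = (\<Sum>A\<in>\<A>. \<phi> A z *
        (\<Sum>g\<in>{g \<in> \<Gamma>3. d g = A}. w g * \<phi> (a g) x * \<phi> (b g) y))"
      by (rule group) (use fin' small in \<open>auto simp: \<Gamma>1_def \<Gamma>2_def \<Gamma>3_def\<close>)
    finally show "T x y z =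
        (\<Sum>A\<in>\<A>. \<phi> A x * (\<Sum>g\<in>{g \<in> \<Gamma>1. a g = A}. w g * \<phi> (b g) y * \<phi> (d g) z)) +
        (\<Sum>A\<in>\<A>. \<phi> A y * (\<Sum>g\<in>{g \<in> \<Gamma>2. b g = A}. w g * \<phi> (a g) x * \<phi> (d g) z)) +
        (\<Sum>A\<in>\<A>. \<phi> A z * (\<Sum>g\<in>{g \<in> \<Gamma>3. d g = A}. w g * \<phi> (a g) x * \<phi> (b g) y))" .
  qed
  then show ?thesis by simp
qed

subsection \<open>Multipartite families\<close>

text \<open>Choice functions on \<open>J\<close> correspond to their images; the inverse map sends
  \<open>A\<close> to the extensional restriction of \<open>inv_into A c\<close>.\<close>

lemma card_transversals:
  assumes "finite J"
  shows "card {A. A \<subseteq> X \<and> inj_on c A \<and> c ` A = J} = (\<Prod>j\<in>J. card {x \<in> X. c x = j})"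
proof -
  let ?P = "PiE J (\<lambda>j. {x \<in> X. c x = j})"
  have "bij_betw (\<lambda>g. g ` J) ?P {A. A \<subseteq> X \<and> inj_on c A \<and> c ` A = J}"
  proof (rule bij_betw_byWitness[where f' = "\<lambda>A. restrict (inv_into A c) J"])
    show "\<forall>g\<in>?P. restrict (inv_into (g ` J) c) J = g"
    proof
      fix g assume g: "g \<in> ?P"
      have "inv_into (g ` J) c j = g j" if "j \<in> J" for j
      proof -
        have "inj_on c (g ` J)" using g by (auto simp: inj_on_def PiE_def Pi_def)
        moreover have "c (g j) = j" using g that by (auto simp: PiE_def Pi_def)
        ultimately show ?thesis using that inv_into_f_f[of c "g ` J" "g j"] by auto
      qed
      then show "restrict (inv_into (g ` J) c) J = g"
        using g by (intro ext) (auto simp: PiE_def extensional_def)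
    qed
    show "\<forall>A\<in>{A. A \<subseteq> X \<and> inj_on c A \<and> c ` A = J}. restrict (inv_into A c) J ` J = A"
      by (auto simp: inv_into_image_cancel)
    show "(\<lambda>g. g ` J) ` ?P \<subseteq> {A. A \<subseteq> X \<and> inj_on c A \<and> c ` A = J}"
      by (force simp: inj_on_def PiE_def Pi_def image_image)
    show "(\<lambda>A. restrict (inv_into A c) J) ` {A. A \<subseteq> X \<and> inj_on c A \<and> c ` A = J} \<subseteq> ?P"
      by (auto simp: inv_into_into f_inv_into_f)
  qed
  from bij_betw_same_card[OF this] show ?thesis by (simp add: card_PiE assms)
qed

section \<open>Expansion into monomials and their degrees\<close>

lemma prod_of_bool_subset:
  assumes "finite I"
  shows "(\<Prod>i\<in>I. of_bool (P i \<subseteq> F)) = (of_bool ((\<Union>i\<in>I. P i) \<subseteq> F) :: 'k::comm_semiring_1)"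
  using assms by (induction I rule: finite_induct) auto

text \<open>
  The index set of the monomials $[P \subseteq F_1][Q \subseteq F_2][R \subseteq F_3]$ of a single factor:
  \<open>({}, {}, {})\<close> stands for the summand $-1$.
\<close>
definition coord_terms :: "'a set \<Rightarrow> ('a set \<times> 'a set \<times> 'a set) set" where
  "coord_terms V = insert ({}, {}, {})
     ((\<lambda>v. ({v}, {v}, {})) ` V \<union> (\<lambda>v. ({}, {v}, {v})) ` V \<union> (\<lambda>v. ({v}, {}, {v})) ` V)"

text \<open>Each cardinality is a sum over \<open>v \<in> V\<close> of products of two membership
  indicators. Every triple except the constant one has \<open>P\<close> or \<open>Q\<close>
  nonempty, so testing \<open>P \<union> Q\<close> suffices to determine the sign.\<close>

lemma coord_factor_expand:
  fixes V :: "'a set"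
  assumes "finite V"
  shows "(of_nat (card (F1 \<inter> F2 \<inter> V)) + of_nat (card (F2 \<inter> F3 \<inter> V)) +
          of_nat (card (F1 \<inter> F3 \<inter> V)) - 1 :: 'k::comm_ring_1) =
    (\<Sum>(P, Q, R)\<in>coord_terms V. (if P \<union> Q = {} then - 1 else 1) *
       (of_bool (P \<subseteq> F1) * of_bool (Q \<subseteq> F2) * of_bool (R \<subseteq> F3)))"
proof -
  have card: "(of_nat (card (A \<inter> B \<inter> V)) :: 'k) = (\<Sum>v\<in>V. of_bool (v \<in> A) * of_bool (v \<in> B))"
    for A B
  proof -
    have "V \<inter> {v. v \<in> A \<and> v \<in> B} = A \<inter> B \<inter> V" by blast
    then show ?thesis using assms by (simp add: of_bool_conj[symmetric] sum_of_bool_eq)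
  qed
  let ?t = "\<lambda>(P, Q, R). (if P \<union> Q = {} then - 1 else 1 :: 'k) *
       (of_bool (P \<subseteq> F1) * of_bool (Q \<subseteq> F2) * of_bool (R \<subseteq> F3))"
  let ?X = "(\<lambda>v. ({v}, {v}, {})) ` V" and ?Y = "(\<lambda>v. ({}, {v}, {v})) ` V"
    and ?Z = "(\<lambda>v. ({v}, {}, {v})) ` V"
  have "sum ?t (coord_terms V) = ?t ({}, {}, {}) + (sum ?t ?X + sum ?t ?Y + sum ?t ?Z)"
    unfolding coord_terms_def using assms
    by (subst sum.insert; (subst sum.union_disjoint)?; (subst sum.union_disjoint)?) auto
  also have "sum ?t ?X = (\<Sum>v\<in>V. of_bool (v \<in> F1) * of_bool (v \<in> F2))"
    by (subst sum.reindex) (auto simp: inj_on_def)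
  also have "sum ?t ?Y = (\<Sum>v\<in>V. of_bool (v \<in> F2) * of_bool (v \<in> F3))"
    by (subst sum.reindex) (auto simp: inj_on_def)
  also have "sum ?t ?Z = (\<Sum>v\<in>V. of_bool (v \<in> F1) * of_bool (v \<in> F3))"
    by (subst sum.reindex) (auto simp: inj_on_def)
  finally show ?thesis by (simp add: card)
qed

text \<open>The last bound says that a factor has degree at most 2, so the product over
  \<open>I\<close> has degree at most \<open>2 * card I\<close>.\<close>

lemma coord_terms_mem:
  assumes "(P, Q, R) \<in> coord_terms V"
  shows "P \<subseteq> V" "Q \<subseteq> V" "R \<subseteq> V" "finite P" "finite Q" "finite R"
    "card P \<le> 1" "card Q \<le> 1" "card R \<le> 1" "card P + card Q + card R \<le> 2"
  using assms by (auto simp: coord_terms_def)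

definition partial_transversals :: "'a set \<Rightarrow> ('a \<Rightarrow> 'i) \<Rightarrow> 'i set \<Rightarrow> nat \<Rightarrow> 'a set set" where
  "partial_transversals X c I m = {A. A \<subseteq> X \<and> inj_on c A \<and> c ` A \<subseteq> I \<and> card A \<le> m}"

text \<open>The pieces have distinct colours and at most one point each, so no colour repeats in the
  union.\<close>

lemma UN_coord_partial_transversal:
  assumes "finite I"
    and "\<And>i. i \<in> I \<Longrightarrow> P i \<subseteq> {x \<in> X. c x = i}"
    and "\<And>i. i \<in> I \<Longrightarrow> finite (P i) \<and> card (P i) \<le> 1"
    and "(\<Sum>i\<in>I. card (P i)) \<le> m"
  shows "(\<Union>i\<in>I. P i) \<in> partial_transversals X c I m"
proof -
  have "inj_on c (\<Union>i\<in>I. P i)"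
  proof (rule inj_onI)
    fix x y assume "x \<in> (\<Union>i\<in>I. P i)" "y \<in> (\<Union>i\<in>I. P i)" "c x = c y"
    then obtain i j where ij: "i \<in> I" "x \<in> P i" "j \<in> I" "y \<in> P j" by blast
    moreover from this have "i = j" using assms(2) \<open>c x = c y\<close> by blast
    ultimately show "x = y" using assms(3)[of i] card_le_Suc0_iff_eq[of "P i"] by auto
  qed
  moreover have "card (\<Union>i\<in>I. P i) \<le> m"
    using card_UN_le[OF assms(1), of P] assms(4) by linarith
  ultimately show ?thesis using assms(2) by (fastforce simp: partial_transversals_def)
qed

text \<open>Sorting by the colour set \<open>J\<close> leaves at most \<open>2 ^ card I\<close>
  cases with at most \<open>D ^ card J\<close> sets each; \<open>D \<ge> 1\<close> raises this to
  \<open>D ^ m\<close>.\<close>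

lemma card_partial_transversals_le:
  assumes "finite X" "finite I" "D \<ge> 1"
    and "\<And>i. i \<in> I \<Longrightarrow> card {x \<in> X. c x = i} \<le> D"
  shows "card (partial_transversals X c I m) \<le> 2 ^ card I * D ^ m"
proof -
  have "partial_transversals X c I m \<subseteq>
      (\<Union>J\<in>{J. J \<subseteq> I \<and> card J \<le> m}. {A. A \<subseteq> X \<and> inj_on c A \<and> c ` A = J})"
    by (auto simp: partial_transversals_def card_image)
  then have "card (partial_transversals X c I m) \<le>
      card (\<Union>J\<in>{J. J \<subseteq> I \<and> card J \<le> m}. {A. A \<subseteq> X \<and> inj_on c A \<and> c ` A = J})"
    using assms by (intro card_mono finite_UN_I) auto
  also have "\<dots> \<le> (\<Sum>J\<in>{J. J \<subseteq> I \<and> card J \<le> m}.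
      card {A. A \<subseteq> X \<and> inj_on c A \<and> c ` A = J})"
    using assms by (intro card_UN_le) auto
  also have "\<dots> \<le> (\<Sum>J\<in>{J. J \<subseteq> I \<and> card J \<le> m}. D ^ m)"
  proof (rule sum_mono)
    fix J assume J: "J \<in> {J. J \<subseteq> I \<and> card J \<le> m}"
    then have "finite J" using assms finite_subset by auto
    then have "card {A. A \<subseteq> X \<and> inj_on c A \<and> c ` A = J} =
        (\<Prod>j\<in>J. card {x \<in> X. c x = j})"
      by (rule card_transversals)
    also have "\<dots> \<le> (\<Prod>j\<in>J. D)" using J assms(4) by (intro prod_mono) auto
    also have "\<dots> \<le> D ^ m" using J assms(3) by (simp add: power_increasing)
    finally show "card {A. A \<subseteq> X \<and> inj_on c A \<and> c ` A = J} \<le> D ^ m" .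
  qed
  also have "\<dots> = card {J. J \<subseteq> I \<and> card J \<le> m} * D ^ m" by simp
  also have "card {J. J \<subseteq> I \<and> card J \<le> m} \<le> card (Pow I)"
    using assms by (intro card_mono) auto
  finally show ?thesis using assms(2) by (simp add: card_Pow)
qed

text \<open>By \<open>bij\<close> every member has exactly one point of each colour.
  Sunflower-freeness makes the tensor \<open>T\<close> diagonal, and each of its monomials has an
  index set of at most a third of the total degree.\<close>

lemma sunflower_free_multipartite_bound:
  fixes c :: "'a \<Rightarrow> 'i"
  assumes "finite X" "finite I"
    and sub: "\<And>F. F \<in> \<G> \<Longrightarrow> F \<subseteq> X"
    and bij: "\<And>F. F \<in> \<G> \<Longrightarrow> bij_betw c F I"
    and free: "sunflower_free \<G>"
  shows "card \<G> \<le> 3 * card (partial_transversals X c I (2 * card I div 3))"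
proof -
  define V where "V i = {x \<in> X. c x = i}" for i
  have finV: "finite (V i)" for i using assms by (simp add: V_def)
  \<comment> \<open>For members of \<open>\<G>\<close>, a factor is 2 if the three points of a
    colour coincide, 0 if exactly two do, and -1 if all differ; 2 and -1 are nonzero in
    \<open>rat\<close>.\<close>
  define T :: "'a set \<Rightarrow> 'a set \<Rightarrow> 'a set \<Rightarrow> rat" where
    "T F1 F2 F3 = (\<Prod>i\<in>I. of_nat (card (F1 \<inter> F2 \<inter> V i)) + of_nat (card (F2 \<inter> F3 \<inter> V i)) +
          of_nat (card (F1 \<inter> F3 \<inter> V i)) - 1)" for F1 F2 F3
  \<comment> \<open>Expanding the product selects one triple per colour. A product of inclusion
    indicators is the indicator for the union, whence \<open>a\<close>, \<open>b\<close> and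
    \<open>d\<close>.\<close>
  define \<Gamma> where "\<Gamma> = PiE I (\<lambda>i. coord_terms (V i))"
  define a where "a g = (\<Union>i\<in>I. fst (g i))" for g :: "'i \<Rightarrow> 'a set \<times> 'a set \<times> 'a set"
  define b where "b g = (\<Union>i\<in>I. fst (snd (g i)))" for g :: "'i \<Rightarrow> 'a set \<times> 'a set \<times> 'a set"
  define d where "d g = (\<Union>i\<in>I. snd (snd (g i)))" for g :: "'i \<Rightarrow> 'a set \<times> 'a set \<times> 'a set"
  define w :: "('i \<Rightarrow> 'a set \<times> 'a set \<times> 'a set) \<Rightarrow> rat" where
    "w g = (\<Prod>i\<in>I. if fst (g i) \<union> fst (snd (g i)) = {} then - 1 else 1)" for g
  have finct: "finite (coord_terms (V i))" for i using finV by (simp add: coord_terms_def)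
  have point: "\<exists>v. F \<inter> V i = {v}" if F: "F \<in> \<G>" and i: "i \<in> I" for F i
  proof -
    have "i \<in> c ` F" using bij[OF F] i by (simp add: bij_betw_def)
    then obtain v where v: "v \<in> F" "c v = i" by blast
    then have "F \<inter> V i = {v}"
      using bij[OF F] sub[OF F] by (auto simp: V_def bij_betw_def inj_on_def)
    then show ?thesis by blast
  qed
  have key: "F1 \<inter> F2 \<subseteq> F3 \<and> F2 \<inter> F3 \<subseteq> F1 \<and> F1 \<inter> F3 \<subseteq> F2"
    if F: "F1 \<in> \<G>" "F2 \<in> \<G>" "F3 \<in> \<G>" and nz: "T F1 F2 F3 \<noteq> 0" for F1 F2 F3
  proof -
    have "(x \<in> F1 \<and> x \<in> F2 \<longrightarrow> x \<in> F3) \<and> (x \<in> F2 \<and> x \<in> F3 \<longrightarrow> x \<in> F1) \<and>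
        (x \<in> F1 \<and> x \<in> F3 \<longrightarrow> x \<in> F2)" if "x \<in> X" "c x \<in> I" for x
    proof -
      obtain u v t where uvt: "F1 \<inter> V (c x) = {u}" "F2 \<inter> V (c x) = {v}" "F3 \<inter> V (c x) = {t}"
        using point F \<open>c x \<in> I\<close> by metis
      have "F1 \<inter> F2 \<inter> V (c x) = {u} \<inter> {v}" "F2 \<inter> F3 \<inter> V (c x) = {v} \<inter> {t}"
          "F1 \<inter> F3 \<inter> V (c x) = {u} \<inter> {t}"
        unfolding uvt[symmetric] by blast+
      moreover have "of_nat (card (F1 \<inter> F2 \<inter> V (c x))) + of_nat (card (F2 \<inter> F3 \<inter> V (c x))) +
          of_nat (card (F1 \<inter> F3 \<inter> V (c x))) - 1 \<noteq> (0 :: rat)"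
        using nz \<open>c x \<in> I\<close> \<open>finite I\<close> by (auto simp: T_def)
      \<comment> \<open>Either all three points agree or no two of them do.\<close>
      ultimately have "(u = v \<longleftrightarrow> v = t) \<and> (u = t \<longleftrightarrow> u = v)"
        by (cases "u = v"; cases "v = t"; cases "u = t") auto
      moreover have "x \<in> V (c x)" using \<open>x \<in> X\<close> by (simp add: V_def)
      then have "x \<in> F1 \<longleftrightarrow> x = u" "x \<in> F2 \<longleftrightarrow> x = v" "x \<in> F3 \<longleftrightarrow> x = t"
        using uvt by blast+
      ultimately show ?thesis by metis
    qed
    then show ?thesis using sub bij F by (auto simp: bij_betw_def; blast)
  qed
  show ?thesis
  proof (rule slice_rank_monomials[where T = T and \<Gamma> = \<Gamma> and w = w
        and \<phi> = "\<lambda>A F. of_bool (A \<subseteq> F)" and a = a and b = b and d = d])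
    show "finite \<G>" using sub \<open>finite X\<close> by (auto intro: finite_subset[of _ "Pow X"])
    show "finite \<Gamma>" unfolding \<Gamma>_def using \<open>finite I\<close> finct by (intro finite_PiE) auto
    show "finite (partial_transversals X c I (2 * card I div 3))"
      unfolding partial_transversals_def using \<open>finite X\<close> by (auto intro: finite_subset[of _ "Pow X"])
  next
    fix F assume F: "F \<in> \<G>"
    have "card (F \<inter> V i) = 1" if "i \<in> I" for i using point[OF F that] by auto
    then show "T F F F \<noteq> 0" using \<open>finite I\<close> by (simp add: T_def)
  next
    fix F1 F2 F3 assume F: "F1 \<in> \<G>" "F2 \<in> \<G>" "F3 \<in> \<G>" and nz: "T F1 F2 F3 \<noteq> 0"
    \<comment> \<open>Members have equal size. If two of the three sets coincide, their intersection
      is that common set; it lies in the third and hence equals it.\<close>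
    have eq: "A = B" if "A \<in> \<G>" "B \<in> \<G>" "A \<subseteq> B" for A B
    proof -
      have "finite B" using sub[OF that(2)] \<open>finite X\<close> by (rule finite_subset)
      moreover have "card A = card B" using that bij[THEN bij_betw_same_card] by metis
      ultimately show ?thesis using that(3) by (simp add: card_subset_eq)
    qed
    have k: "F1 \<inter> F2 \<subseteq> F3" "F2 \<inter> F3 \<subseteq> F1" "F1 \<inter> F3 \<subseteq> F2"
      using key[OF F nz] by auto
    \<comment> \<open>All pairwise intersections equal the triple one, so in the absence of a
      sunflower two of the sets must coincide.\<close>
    have "\<not> sunflower3 F1 F2 F3" using free F by (auto simp: sunflower_free_def)
    moreover have "F1 \<inter> F2 = F1 \<inter> F2 \<inter> F3" "F1 \<inter> F3 = F1 \<inter> F2 \<inter> F3" "F2 \<inter> F3 = F1 \<inter> F2 \<inter> F3"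
      using k by blast+
    ultimately consider "F1 = F2" | "F1 = F3" | "F2 = F3" by (auto simp: sunflower3_def)
    then show "F1 = F2 \<and> F2 = F3"
      using eq[of F1 F2] eq[of F1 F3] eq[of F2 F1] F k by cases auto
  next
    fix F1 F2 F3
    have "T F1 F2 F3 = (\<Prod>i\<in>I. \<Sum>t\<in>coord_terms (V i).
        (if fst t \<union> fst (snd t) = {} then - 1 else 1) *
        (of_bool (fst t \<subseteq> F1) * of_bool (fst (snd t) \<subseteq> F2) * of_bool (snd (snd t) \<subseteq> F3)))"
      unfolding T_def by (simp add: coord_factor_expand finV case_prod_unfold)
    also have "\<dots> = (\<Sum>g\<in>\<Gamma>. \<Prod>i\<in>I.
        (if fst (g i) \<union> fst (snd (g i)) = {} then - 1 else 1) *
        (of_bool (fst (g i) \<subseteq> F1) * of_bool (fst (snd (g i)) \<subseteq> F2) * of_bool (snd (snd (g i)) \<subseteq> F3)))"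
      unfolding \<Gamma>_def by (rule prod_sum_PiE) (use \<open>finite I\<close> finct in auto)
    also have "\<dots> = (\<Sum>g\<in>\<Gamma>. w g * of_bool (a g \<subseteq> F1) * of_bool (b g \<subseteq> F2) * of_bool (d g \<subseteq> F3))"
      unfolding prod.distrib prod_of_bool_subset[OF \<open>finite I\<close>] w_def a_def b_def d_def
      by (simp add: mult.assoc)
    finally show "T F1 F2 F3 =
      (\<Sum>g\<in>\<Gamma>. w g * of_bool (a g \<subseteq> F1) * of_bool (b g \<subseteq> F2) * of_bool (d g \<subseteq> F3))" .
  next
    fix g assume g: "g \<in> \<Gamma>"
    have m: "(fst (g i), fst (snd (g i)), snd (snd (g i))) \<in> coord_terms (V i)" if "i \<in> I" for i
      using g that by (auto simp: \<Gamma>_def PiE_def Pi_def)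
    note mem = coord_terms_mem[OF m, unfolded V_def]
    have "(\<Sum>i\<in>I. card (fst (g i)) + card (fst (snd (g i))) + card (snd (snd (g i)))) \<le> (\<Sum>i\<in>I. 2)"
      by (intro sum_mono mem)
    \<comment> \<open>Of three naturals with sum at most \<open>2 * card I\<close>, the smallest is
      at most a third of it, rounded down.\<close>
    then have "(\<Sum>i\<in>I. card (fst (g i))) \<le> 2 * card I div 3 \<or>
        (\<Sum>i\<in>I. card (fst (snd (g i)))) \<le> 2 * card I div 3 \<or>
        (\<Sum>i\<in>I. card (snd (snd (g i)))) \<le> 2 * card I div 3"
      unfolding sum.distrib by simp linarith
    moreover have "a g \<in> partial_transversals X c I (2 * card I div 3)"
      if "(\<Sum>i\<in>I. card (fst (g i))) \<le> 2 * card I div 3"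
      unfolding a_def using mem that by (intro UN_coord_partial_transversal \<open>finite I\<close>) auto
    moreover have "b g \<in> partial_transversals X c I (2 * card I div 3)"
      if "(\<Sum>i\<in>I. card (fst (snd (g i)))) \<le> 2 * card I div 3"
      unfolding b_def using mem that by (intro UN_coord_partial_transversal \<open>finite I\<close>) auto
    moreover have "d g \<in> partial_transversals X c I (2 * card I div 3)"
      if "(\<Sum>i\<in>I. card (snd (snd (g i)))) \<le> 2 * card I div 3"
      unfolding d_def using mem that by (intro UN_coord_partial_transversal \<open>finite I\<close>) auto
    ultimately show "a g \<in> partial_transversals X c I (2 * card I div 3) \<or>
        b g \<in> partial_transversals X c I (2 * card I div 3) \<or>
        d g \<in> partial_transversals X c I (2 * card I div 3)"
      by blast
  qed
qed

subsection \<open>Balanced colourings\<close>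

text \<open>A bijection of the two sets is glued to one of their complements. This supplies the
  symmetry in the count of colourings.\<close>

lemma ex_bij_betw_mapping_subsets:
  assumes "finite X" "S \<subseteq> X" "S' \<subseteq> X" "card S = card S'"
  shows "\<exists>\<pi>. bij_betw \<pi> X X \<and> \<pi> ` S = S'"
proof -
  have fin: "finite S" "finite S'" using assms finite_subset by auto
  obtain f where f: "bij_betw f S S'"
    using finite_same_card_bij[OF fin assms(4)] by blast
  have "card (X - S) = card (X - S')" using assms fin by (simp add: card_Diff_subset)
  then obtain g where g: "bij_betw g (X - S) (X - S')"
    using finite_same_card_bij[of "X - S" "X - S'"] assms by auto
  let ?\<pi> = "\<lambda>x. if x \<in> S then f x else g x"
  have "bij_betw ?\<pi> (S \<union> (X - S)) (S' \<union> (X - S'))"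
    using bij_betw_disjoint_Un[OF f g] by blast
  moreover have "S \<union> (X - S) = X" "S' \<union> (X - S') = X" using assms by auto
  moreover have "?\<pi> ` S = S'" using f by (auto simp: bij_betw_def)
  ultimately show ?thesis by metis
qed

text \<open>Double counting of pairs of a \<open>k\<close>-set and a balanced colouring injective on
  it: every \<open>k\<close>-set lies in equally many pairs, every colouring in
  \<open>D ^ k\<close>. The average over colourings gives the ratio, cleared of its denominator to
  stay in \<open>nat\<close>.\<close>

lemma exists_balanced_colouring:
  fixes k D :: nat
  assumes "finite X" "card X = k * D"
    and \<F>: "\<forall>F\<in>\<F>. F \<subseteq> X \<and> card F = k"
  shows "\<exists>c. (\<forall>x\<in>X. c x < k) \<and> (\<forall>i<k. card {x \<in> X. c x = i} = D) \<and>
    card \<F> * D ^ k \<le> card {F \<in> \<F>. inj_on c F} * (k * D choose k)"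
proof -
  define \<C> where "\<C> = {c \<in> X \<rightarrow>\<^sub>E {..<k}. \<forall>i<k. card {x \<in> X. c x = i} = D}"
  have fin\<C>: "finite \<C>" unfolding \<C>_def using assms(1) by (simp add: finite_PiE)
  \<comment> \<open>Colouring a \<open>k\<close> by \<open>D\<close> grid by rows shows that
    \<open>\<C>\<close> is nonempty, as the strict inequality in the averaging requires.\<close>
  have "card X = card ({..<k} \<times> {..<D})" using assms by simp
  with finite_same_card_bij[OF assms(1)] obtain h where h: "bij_betw h X ({..<k} \<times> {..<D})"
    by (meson finite_SigmaI finite_lessThan)
  have "restrict (fst \<circ> h) X \<in> \<C>"
  proof -
    have "card {x \<in> X. fst (h x) = i} = D" if "i < k" for i
    proof -
      have "h ` {x \<in> X. fst (h x) = i} = h ` X \<inter> {p. fst p = i}" by blast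
      also have "\<dots> = {i} \<times> {..<D}" using h that by (auto simp: bij_betw_def)
      finally have "card (h ` {x \<in> X. fst (h x) = i}) = D" by simp
      moreover have "inj_on h {x \<in> X. fst (h x) = i}"
        using h by (auto simp: bij_betw_def intro: inj_on_subset)
      ultimately show ?thesis by (simp add: card_image)
    qed
    moreover have "{x \<in> X. restrict (fst \<circ> h) X x = i} = {x \<in> X. fst (h x) = i}" for i by auto
    moreover have "fst (h x) < k" if "x \<in> X" for x
      using bij_betwE[OF h] that by (auto simp: mem_Times_iff)
    ultimately show ?thesis by (auto simp: \<C>_def)
  qed
  then have "card \<C> > 0" using fin\<C> card_gt_0_iff by blast
  \<comment> \<open>By symmetry the number of colourings injective on a \<open>k\<close>-set does not depend on the \<open>k\<close>-set.\<close>
  define N where "N S = card {c \<in> \<C>. inj_on c S}" for S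
  have N_le: "N S' \<le> N S" if S: "S \<subseteq> X" "S' \<subseteq> X" "card S = card S'" for S S'
  proof -
    obtain \<pi> where \<pi>: "bij_betw \<pi> X X" "\<pi> ` S = S'"
      using ex_bij_betw_mapping_subsets[OF assms(1) S] by blast
    have \<pi>X: "\<pi> x \<in> X" if "x \<in> X" for x using \<pi>(1) that by (auto simp: bij_betw_def)
    have \<pi>inj: "inj_on \<pi> X" and \<pi>img: "\<pi> ` X = X" using \<pi>(1) by (auto simp: bij_betw_def)
    \<comment> \<open>Precomposition with \<open>\<pi>\<close> turns injectivity on
      \<open>S'\<close> into injectivity on \<open>S\<close>; restriction to \<open>X\<close> keeps
      the colouring extensional.\<close>
    let ?\<Phi> = "\<lambda>c. restrict (c \<circ> \<pi>) X"
    have "?\<Phi> ` {c \<in> \<C>. inj_on c S'} \<subseteq> {c \<in> \<C>. inj_on c S}"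
    proof
      fix c' assume "c' \<in> ?\<Phi> ` {c \<in> \<C>. inj_on c S'}"
      then obtain c where c: "c \<in> \<C>" "inj_on c S'" and c': "c' = ?\<Phi> c" by blast
      have "card {x \<in> X. c' x = i} = D" if "i < k" for i
      proof -
        have "bij_betw \<pi> {x \<in> X. c' x = i} {x \<in> X. c x = i}"
          unfolding bij_betw_def
        proof
          show "inj_on \<pi> {x \<in> X. c' x = i}" using \<pi>inj by (rule inj_on_subset) auto
          show "\<pi> ` {x \<in> X. c' x = i} = {x \<in> X. c x = i}"
          proof
            show "\<pi> ` {x \<in> X. c' x = i} \<subseteq> {x \<in> X. c x = i}" using \<pi>X by (auto simp: c')
            show "{x \<in> X. c x = i} \<subseteq> \<pi> ` {x \<in> X. c' x = i}"
            proof
              fix y assume y: "y \<in> {x \<in> X. c x = i}"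
              then obtain x where "x \<in> X" "y = \<pi> x" using \<pi>img by blast
              then show "y \<in> \<pi> ` {x \<in> X. c' x = i}" using y by (auto simp: c')
            qed
          qed
        qed
        from bij_betw_same_card[OF this] show ?thesis using c(1) that by (simp add: \<C>_def)
      qed
      moreover have "c' \<in> X \<rightarrow>\<^sub>E {..<k}" using c(1) \<pi>X by (auto simp: c' \<C>_def PiE_def Pi_def)
      moreover have "inj_on (c \<circ> \<pi>) S"
        using \<pi> c(2) S(1) \<pi>inj by (intro comp_inj_on) (auto intro: inj_on_subset)
      then have "inj_on c' S" using S(1) by (auto simp: c' inj_on_def subset_iff)
      ultimately show "c' \<in> {c \<in> \<C>. inj_on c S}" by (simp add: \<C>_def)
    qed
    moreover have "inj_on ?\<Phi> {c \<in> \<C>. inj_on c S'}"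
    proof (rule inj_onI)
      fix c1 c2 assume c: "c1 \<in> {c \<in> \<C>. inj_on c S'}" "c2 \<in> {c \<in> \<C>. inj_on c S'}"
        and eq: "?\<Phi> c1 = ?\<Phi> c2"
      have "c1 y = c2 y" if y: "y \<in> X" for y
      proof -
        obtain x where "x \<in> X" "y = \<pi> x" using y \<pi>img by blast
        then show ?thesis using fun_cong[OF eq, of x] by simp
      qed
      then show "c1 = c2" using c by (auto simp: \<C>_def intro: PiE_ext)
    qed
    ultimately show ?thesis unfolding N_def using fin\<C> by (intro card_inj_on_le) auto
  qed
  define K where "K = {S. S \<subseteq> X \<and> card S = k}"
  have K: "finite K" "card K = (k * D choose k)"
    using n_subsets[OF assms(1), of k] assms by (auto simp: K_def)
  have "N S' = N S" if "S \<in> K" "S' \<in> K" for S S'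
    using that N_le[of S S'] N_le[of S' S] by (auto simp: K_def)
  then obtain n where n: "\<And>S. S \<in> K \<Longrightarrow> N S = n" by metis
  have double: "(\<Sum>c\<in>\<C>. card {S \<in> \<S>. inj_on c S}) = card \<S> * n" if "\<S> \<subseteq> K" for \<S>
  proof -
    have "finite \<S>" using that K finite_subset by blast
    have "(\<Sum>c\<in>\<C>. card {S \<in> \<S>. inj_on c S}) = (\<Sum>S\<in>\<S>. card {c \<in> \<C>. inj_on c S})"
      using sum_multicount_gen[OF fin\<C> \<open>finite \<S>\<close>, of "\<lambda>c S. inj_on c S"] by simp
    also have "\<dots> = (\<Sum>S\<in>\<S>. n)" using n that by (intro sum.cong) (auto simp: N_def)
    finally show ?thesis by simp
  qed
  \<comment> \<open>\<open>k\<close> distinct colours exhaust \<open>{..<k}\<close>, so these sets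
    are exactly the full transversals.\<close>
  have trans: "card {S \<in> K. inj_on c S} = D ^ k" if "c \<in> \<C>" for c
  proof -
    have cX: "c ` X \<subseteq> {..<k}" using that by (auto simp: \<C>_def)
    have "{S \<in> K. inj_on c S} = {A. A \<subseteq> X \<and> inj_on c A \<and> c ` A = {..<k}}"
    proof (intro Collect_cong set_eqI iffI; clarsimp simp: K_def)
      fix S assume S: "S \<subseteq> X" "inj_on c S" "k = card S"
      have "c ` S \<subseteq> {..<k}" "card (c ` S) = card {..<k}"
        using S cX by (auto simp: card_image)
      then show "c ` S = {..<card S}" using S(3) by (simp add: card_subset_eq)
    next
      fix S assume "inj_on c S" "c ` S = {..<k}"
      then show "card S = k" using card_image[of c S] by simp
    qed
    then show ?thesis using that by (simp add: card_transversals \<C>_def)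
  qed
  have "\<exists>c\<in>\<C>. card \<F> * D ^ k \<le> card {F \<in> \<F>. inj_on c F} * (k * D choose k)"
  proof (rule ccontr)
    assume "\<not> ?thesis"
    then have "(\<Sum>c\<in>\<C>. card {F \<in> \<F>. inj_on c F} * (k * D choose k)) < (\<Sum>c\<in>\<C>. card \<F> * D ^ k)"
      using fin\<C> \<open>card \<C> > 0\<close> by (intro sum_strict_mono) auto
    also have "(\<Sum>c\<in>\<C>. card \<F> * D ^ k) = card \<F> * (card \<C> * D ^ k)" by simp
    \<comment> \<open>Double counting over all \<open>k\<close>-sets determines
      \<open>n\<close>.\<close>
    also have "card \<C> * D ^ k = (k * D choose k) * n"
      using double[of K] trans K by simp
    also have "(\<Sum>c\<in>\<C>. card {F \<in> \<F>. inj_on c F} * (k * D choose k)) =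
        card \<F> * n * (k * D choose k)"
      using \<F> by (subst sum_distrib_right[symmetric], subst double) (auto simp: K_def)
    finally show False by simp
  qed
  then obtain c where "c \<in> \<C>" "card \<F> * D ^ k \<le> card {F \<in> \<F>. inj_on c F} * (k * D choose k)"
    by blast
  then show ?thesis by (intro exI[of _ c]) (auto simp: \<C>_def)
qed

section \<open>From multipartite to uniform families\<close>

text \<open>The left side is one term of the exponential series, whose terms are all
  nonnegative.\<close>

lemma power_div_fact_le_exp:
  fixes x :: real
  assumes "x \<ge> 0"
  shows "x ^ n / fact n \<le> exp x"
proof -
  have "(\<Sum>i\<in>{n}. x ^ i /\<^sub>R fact i) \<le> (\<Sum>i. x ^ i /\<^sub>R fact i)"
    using assms by (intro sum_le_suminf summable_exp_generic) auto
  then show ?thesis by (simp add: exp_def field_simps)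
qed

text \<open>The members on which a good colouring is injective obey the multipartite bound. Passing
  back to \<open>\<F>\<close> costs a factor \<open>(k * D choose k) / D ^ k\<close>, at most
  \<open>k ^ k / fact k\<close> and hence at most \<open>exp k\<close>.\<close>

lemma sunflower_free_uniform_bound:
  fixes k D :: nat
  assumes "finite X" "card X = k * D" "D \<ge> 1"
    and \<F>: "\<forall>F\<in>\<F>. F \<subseteq> X \<and> card F = k"
    and free: "sunflower_free \<F>"
  shows "real (card \<F>) \<le> 3 * (2 * exp 1) ^ k * real D ^ (2 * k div 3)"
proof -
  from exists_balanced_colouring[OF assms(1,2) \<F>]
  obtain c where c: "\<forall>x\<in>X. c x < k" "\<forall>i<k. card {x \<in> X. c x = i} = D"
    and many: "card \<F> * D ^ k \<le> card {F \<in> \<F>. inj_on c F} * (k * D choose k)"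
    by (elim exE conjE)
  define \<G> where "\<G> = {F \<in> \<F>. inj_on c F}"
  define m where "m = 2 * k div 3"
  have "card \<G> \<le> 3 * card (partial_transversals X c {..<k} (2 * card {..<k} div 3))"
  proof (rule sunflower_free_multipartite_bound[OF assms(1)])
    show "F \<subseteq> X" if "F \<in> \<G>" for F using that \<F> by (auto simp: \<G>_def)
    show "bij_betw c F {..<k}" if "F \<in> \<G>" for F
    proof -
      have "inj_on c F" "F \<subseteq> X" "card F = k" using that \<F> by (auto simp: \<G>_def)
      moreover from this have "c ` F \<subseteq> {..<k}" "card (c ` F) = card {..<k}"
        using c(1) by (auto simp: card_image)
      then have "c ` F = {..<k}" by (simp add: card_subset_eq)
      ultimately show ?thesis by (simp add: bij_betw_def)
    qed
    show "sunflower_free \<G>" using free by (auto simp: sunflower_free_def \<G>_def)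
  qed simp
  also have "card (partial_transversals X c {..<k} (2 * card {..<k} div 3)) \<le> 2 ^ k * D ^ m"
    using card_partial_transversals_le[OF assms(1) _ assms(3), of "{..<k}" c m] c(2)
    by (simp add: m_def)
  finally have \<G>: "card \<G> \<le> 3 * (2 ^ k * D ^ m)" by simp
  have "card \<F> * fact k * D ^ k \<le> card \<G> * ((k * D choose k) * fact k)"
    using many by (simp add: \<G>_def mult_ac)
  \<comment> \<open>The falling factorial \<open>(k * D choose k) * fact k\<close> is at most
    \<open>(k * D) ^ k\<close>, whose factor \<open>D ^ k\<close> then cancels.\<close>
  also have "\<dots> \<le> 3 * (2 ^ k * D ^ m) * (k * D) ^ k"
    by (intro mult_mono \<G> binomial_fact_pow) auto
  also have "\<dots> = 3 * 2 ^ k * D ^ m * k ^ k * D ^ k" by (simp add: power_mult_distrib)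
  finally have "card \<F> * fact k \<le> 3 * 2 ^ k * D ^ m * k ^ k" using assms(3) by simp
  then have "real (card \<F> * fact k) \<le> real (3 * 2 ^ k * D ^ m * k ^ k)"
    by (rule of_nat_mono)
  then have "real (card \<F>) * fact k \<le> 3 * 2 ^ k * real D ^ m * real k ^ k" by simp
  then have "real (card \<F>) \<le> 3 * 2 ^ k * real D ^ m * (real k ^ k / fact k)"
    by (simp add: field_simps)
  also have "\<dots> \<le> 3 * 2 ^ k * real D ^ m * exp (real k)"
    by (intro mult_left_mono power_div_fact_le_exp) auto
  also have "exp (real k) = exp 1 ^ k" by (simp add: exp_of_nat_mult[symmetric])
  finally show ?thesis by (simp add: m_def power_mult_distrib mult_ac)
qed

section \<open>Padding of the ground set and comparison of constants\<close>

theorem theorem1p8: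
  fixes k n M :: nat and \<F> :: "nat set set"
  assumes "k \<ge> 1"
    and "\<forall>F\<in>\<F>. F \<subseteq> {1..n}"
    and "uniform_family k \<F>"
    and "sunflower_free \<F>"
    and "M = card (\<Union>\<F>)"
    and "M > k"
  shows "real (card \<F>) \<le>
           3 * (real_of_int \<lceil>2 * real k / 3\<rceil> + 1)
             * (2 powr (1/3) * (3 * exp 1)) ^ k
             * (real_of_int \<lceil>real M / real k\<rceil> - 1) ^ nat \<lceil>2 * real k / 3\<rceil>"
proof -
  define D where "D = nat \<lceil>real M / real k\<rceil>"
  define m where "m = 2 * k div 3"
  define r where "r = nat \<lceil>2 * real k / 3\<rceil>"
  \<comment> \<open>\<open>M > k\<close> yields \<open>D \<ge> 2\<close>, on which the comparison of
    \<open>D\<close> with \<open>2 * (D - 1)\<close> rests.\<close>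
  have "real M / real k > 1" using assms(1,6) by simp
  then have D: "real_of_int \<lceil>real M / real k\<rceil> = real D" "real D \<ge> real M / real k" "D \<ge> 2"
    unfolding D_def by linarith+
  have "real m \<le> 2 * real k / 3" unfolding m_def by linarith
  then have mr: "m \<le> r" "real_of_int \<lceil>2 * real k / 3\<rceil> = real r"
    unfolding r_def by linarith+
  have "real M \<le> real (k * D)" using D(2) assms(1) by (simp add: field_simps)
  then have "M \<le> k * D" by linarith
  have "\<Union>\<F> \<subseteq> {1..n}" using assms(2) by blast
  then have fin: "finite (\<Union>\<F>)" by (rule finite_subset) simp
  \<comment> \<open>Dummy points pad the union to exactly \<open>k * D\<close> points; they lie in
    no member, so the family stays the same.\<close>
  obtain B where B: "finite B" "card B = k * D - M" "\<Union>\<F> \<inter> B = {}"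
    using finite_arbitrarily_large_disj[OF infinite_UNIV_nat fin] by metis
  have "real (card \<F>) \<le> 3 * (2 * exp 1) ^ k * real D ^ m"
    unfolding m_def
  proof (rule sunflower_free_uniform_bound)
    show "finite (\<Union>\<F> \<union> B)" using fin B by simp
    show "card (\<Union>\<F> \<union> B) = k * D"
      using fin B assms(5) \<open>M \<le> k * D\<close> by (simp add: card_Un_disjoint)
    show "\<forall>F\<in>\<F>. F \<subseteq> \<Union>\<F> \<union> B \<and> card F = k"
      using assms(3) by (auto simp: uniform_family_def)
  qed (use D assms(4) in auto)
  \<comment> \<open>From \<open>D \<le> 2 * (D - 1)\<close> a factor \<open>2 ^ m\<close> splits
    off, at most the \<open>k\<close>-th power of \<open>2 powr (2/3)\<close>. Since
    \<open>D - 1 \<ge> 1\<close>, the exponent may rise from the floor \<open>m\<close> to the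
    ceiling \<open>r\<close>.\<close>
  also have "real D ^ m \<le> (2 powr (2/3)) ^ k * (real D - 1) ^ r"
  proof -
    have "real D ^ m \<le> (2 * (real D - 1)) ^ m" using D(3) by (intro power_mono) auto
    also have "\<dots> = 2 powr real m * (real D - 1) ^ m"
      by (simp only: power_mult_distrib powr_realpow zero_less_numeral)
    also have "\<dots> \<le> 2 powr (2/3 * real k) * (real D - 1) ^ r"
      using D(3) mr(1) \<open>real m \<le> 2 * real k / 3\<close>
      by (intro mult_mono powr_mono power_increasing) auto
    also have "2 powr (2/3 * real k) = (2 powr (2/3 :: real)) ^ k"
      by (simp add: powr_power mult_ac)
    finally show ?thesis .
  qed
  also have "3 * (2 * exp 1) ^ k * ((2 powr (2/3)) ^ k * (real D - 1) ^ r) =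
      3 * (2 * 2 powr (2/3) * exp 1) ^ k * (real D - 1) ^ r"
    by (simp add: power_mult_distrib mult_ac)
  also have "\<dots> \<le> (3 * (real r + 1)) * (2 powr (1/3) * (3 * exp 1)) ^ k * (real D - 1) ^ r"
  proof -
    \<comment> \<open>The cube root of 2 is at most 3/2 because 2 is at most 27/8.\<close>
    have "(2 powr (1/3)) ^ 3 = (2 :: real)" by (simp add: powr_power)
    then have "(2 powr (1/3)) ^ 3 \<le> (3/2 :: real) ^ 3" by (simp add: power_divide)
    then have "2 powr (1/3) \<le> (3/2 :: real)" by (subst (asm) power_mono_iff) auto
    then have "2 powr (1/3) * (2 * 2 powr (1/3)) \<le> 2 powr (1/3) * (3 :: real)"
      by (intro mult_left_mono) auto
    moreover have "2 powr (2/3) = 2 powr (1/3) * (2 powr (1/3) :: real)"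
      by (simp add: powr_add[symmetric])
    ultimately have "2 * 2 powr (2/3) \<le> 2 powr (1/3) * (3 :: real)" by simp
    then have "2 * 2 powr (2/3) * exp 1 \<le> 2 powr (1/3) * (3 * exp (1 :: real))"
      by (simp add: mult.assoc[symmetric])
    then have "(2 * 2 powr (2/3) * exp 1) ^ k \<le> (2 powr (1/3) * (3 * exp (1 :: real))) ^ k"
      by (rule power_mono) simp
    \<comment> \<open>The factor \<open>real r + 1\<close>, which is at least 1, enters
      here.\<close>
    then show ?thesis using D(3) by (intro mult_mono) auto
  qed
  finally show ?thesis unfolding D(1) mr(2) r_def[symmetric] by simp
qed

end
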